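(* Let $\mathcal M$ be an additive noise SCM with one binary sensitive attribute $\mathbf S\in\{0,1\}$ and let $h:\mathcal V\to\{-1,+1\}$ be a (measurable) binary classifier. Let $A_C^{\neq}$ be its counterfactual unfair area, with positive and negative regions $A^{\neq}_{C,+}$ and $A^{\neq}_{C,-}$. Let $\mathcal C\subset A^{\neq}_{C,-}$ be measurable and let $h'$ be the classifier obtained from $h$ by flipping the labels of all instances in $\mathcal C$ to positive. Let $\mathcal C_+$ be the set of points of $A^{\neq}_{C,+}$ whose twin belongs to $\mathcal C$. Then the probability of the counterfactual unfair area of $h'$ equals $$\mathbb P_{\mathcal V}(A_C^{\neq})-\mathbb P_{\mathcal V}(\mathcal C)-\mathbb P_{\mathcal V}(\mathcal C_+).$$ In particular, if $\mathcal C=A^{\neq}_{C,-}$, then counterfactual unfairness is completely removed, i.e. the counterfactual unfair area of $h'$ has probability $0$.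
   Context: $\mathcal M$ is a structural causal model (SCM) on a directed acyclic graph with vertices $1,\dots,n$, of additive noise type: $\mathbf V_i=f_i(\mathbf V_{\mathrm{Pa}(i)})+\mathbf U_i$ with measurable $f_i$ and independent noises $\mathbf U_i$, where $\mathrm{Pa}(i)$ denotes the parents of $i$. $\mathcal V$ is the feature space and $\mathbb P_{\mathcal V}$ the induced distribution of $\mathbf V=(\mathbf V_1,\dots,\mathbf V_n)$ on it. The sensitive attribute $\mathbf S$ is one of the features, say with index $i_0$, taking values in $\{0,1\}$. Twins. For $s\in\{0,1\}$, the counterfactual $\ddot v_s=\mathbf{CF}(v,do(\mathbf S:=s))$ of $v\in\mathcal V$ is computed recursively along the graph, keeping the noises of the non-sensitive features: its $i_0$-th coordinate is $s$, and for $i\ne i_0$, $(\ddot v_s)_i=f_i\big((\ddot v_s)_{\mathrm{Pa}(i)}\big)+\big(v_i-f_i(v_{\mathrm{Pa}(i)})\big)$. The feature space $\mathcal V$ is assumed closed under $v\mapsto\ddot v_s$. The *twin* of $v$ is $\ddot v_{1-s}$, where $s=v_{i_0}$ is the value of the sensitive attribute of $v$. Counterfactual unfair area. For a binary classifier $g:\mathcal V\to\{-1,+1\}$, its counterfactual unfair area is the set of all $v\in\mathcal V$ such that $g(v)\ne g(\ddot v_s)$ for some $s\in\{0,1\}$. For $h$ it is denoted $A_C^{\neq}$, and its positive and negative regions are $A^{\neq}_{C,\pm}=\{v\in A_C^{\neq}:h(v)=\pm1\}$. *)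

theory Defs
  imports "HOL-Probability.Probability"
begin

text \<open>
  Vertices are \<open>{1..n}\<close>; a pair \<open>(j, i)\<close> in \<open>E\<close> is an edge from \<open>j\<close> to \<open>i\<close>. Feature vectors are
  extensional functions on \<open>{1..n}\<close>, i.e. points of the product space \<open>\<Pi>\<^sub>M i\<in>{1..n}. borel\<close>, and the
  structural function of vertex \<open>i\<close> takes a point of the product space over the parents of \<open>i\<close>.
\<close>

definition parents :: "(nat \<times> nat) set \<Rightarrow> nat \<Rightarrow> nat set" where
  "parents E i = {j. (j, i) \<in> E}"

type_synonym mechanism = "nat \<Rightarrow> (nat \<Rightarrow> real) \<Rightarrow> real"

locale additive_noise_SCM = prob_space M
  for M :: "'w measure" +
  fixes n :: nat
    and E :: "(nat \<times> nat) set"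
    and f :: mechanism
    and U :: "nat \<Rightarrow> 'w \<Rightarrow> real"
    and V :: "nat \<Rightarrow> 'w \<Rightarrow> real"
  assumes edges: "E \<subseteq> {1..n} \<times> {1..n}"
    and acyclic: "acyclic E"
    and mechanism_measurable:
      "\<And>i. i \<in> {1..n} \<Longrightarrow> f i \<in> borel_measurable (\<Pi>\<^sub>M j\<in>parents E i. borel)"
    and noise_indep: "indep_vars (\<lambda>_. borel) U {1..n}"
    and structural_equation:
      "\<And>i \<omega>. i \<in> {1..n} \<Longrightarrow> \<omega> \<in> space M \<Longrightarrow>
        V i \<omega> = f i (\<lambda>j\<in>parents E i. V j \<omega>) + U i \<omega>"

text \<open>
  Well-founded recursion along the edges; for \<open>wf E\<close> (which holds for finite acyclic \<open>E\<close>) it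
  satisfies the defining equations of the counterfactual, see \<open>counterfactual_rec\<close> below.
\<close>

definition counterfactual ::
    "nat \<Rightarrow> (nat \<times> nat) set \<Rightarrow> mechanism \<Rightarrow> nat \<Rightarrow> real \<Rightarrow> (nat \<Rightarrow> real) \<Rightarrow> nat \<Rightarrow> real" where
  "counterfactual n E f i0 s v = restrict
     (wfrec E (\<lambda>w i. if i = i0 then s
        else f i (\<lambda>j\<in>parents E i. w j) + (v i - f i (\<lambda>j\<in>parents E i. v j)))) {1..n}"

lemma counterfactual_rec:
  assumes "E \<subseteq> {1..n} \<times> {1..n}" "acyclic E" "i \<in> {1..n}"
  shows "counterfactual n E f i0 s v i =
    (if i = i0 then s
     else f i (\<lambda>j\<in>parents E i. counterfactual n E f i0 s v j)
       + (v i - f i (\<lambda>j\<in>parents E i. v j)))"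
proof -
  define H where "H = (\<lambda>w i. if i = i0 then s
        else f i (\<lambda>j\<in>parents E i. w j) + (v i - f i (\<lambda>j\<in>parents E i. v j)))"
  have "finite E" using assms(1) by (rule finite_subset) simp
  then have wf: "wf E" using assms(2) by (rule finite_acyclic_wf)
  have cf: "counterfactual n E f i0 s v j = wfrec E H j" if "j \<in> {1..n}" for j
    using that by (simp add: counterfactual_def H_def)
  have "wfrec E H i = H (cut (wfrec E H) E i) i" by (rule wfrec[OF wf])
  also have "(\<lambda>j\<in>parents E i. cut (wfrec E H) E i j)
      = (\<lambda>j\<in>parents E i. counterfactual n E f i0 s v j)"
    using assms(1) cf by (intro restrict_ext) (auto simp: parents_def cut_def)
  then have "H (cut (wfrec E H) E i) i = H (counterfactual n E f i0 s v) i"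
    by (simp add: H_def)
  finally show ?thesis using cf[OF assms(3)] by (simp add: H_def)
qed

text \<open>\<open>FS\<close> is the feature space, \<open>i0\<close> the index of the sensitive attribute.\<close>

locale binary_sensitive_SCM = additive_noise_SCM M n E f U V
  for M :: "'w measure" and n E f U V +
  fixes i0 :: nat
    and FS :: "(nat \<Rightarrow> real) set"
  assumes sensitive_index: "i0 \<in> {1..n}"
    and feature_space: "FS \<subseteq> space (\<Pi>\<^sub>M i\<in>{1..n}. borel)"
    and features_in_space: "\<And>\<omega>. \<omega> \<in> space M \<Longrightarrow> (\<lambda>i\<in>{1..n}. V i \<omega>) \<in> FS"
    and sensitive_binary: "\<And>v. v \<in> FS \<Longrightarrow> v i0 \<in> {0, 1}"
    and counterfactual_closed:
      "\<And>v s. v \<in> FS \<Longrightarrow> s \<in> {0, 1} \<Longrightarrow> counterfactual n E f i0 s v \<in> FS"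

definition feature_distr ::
    "'w measure \<Rightarrow> nat \<Rightarrow> (nat \<Rightarrow> 'w \<Rightarrow> real) \<Rightarrow> (nat \<Rightarrow> real) set \<Rightarrow> (nat \<Rightarrow> real) measure" where
  "feature_distr M n V FS =
     distr M (restrict_space (\<Pi>\<^sub>M i\<in>{1..n}. borel) FS) (\<lambda>\<omega>. \<lambda>i\<in>{1..n}. V i \<omega>)"

definition twin ::
    "nat \<Rightarrow> (nat \<times> nat) set \<Rightarrow> mechanism \<Rightarrow> nat \<Rightarrow> (nat \<Rightarrow> real) \<Rightarrow> nat \<Rightarrow> real" where
  "twin n E f i0 v = counterfactual n E f i0 (1 - v i0) v"

definition unfair_area ::
    "nat \<Rightarrow> (nat \<times> nat) set \<Rightarrow> mechanism \<Rightarrow> nat \<Rightarrow> (nat \<Rightarrow> real) set \<Rightarrow> ((nat \<Rightarrow> real) \<Rightarrow> int)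
      \<Rightarrow> (nat \<Rightarrow> real) set" where
  "unfair_area n E f i0 FS g =
     {v \<in> FS. \<exists>s\<in>{0, 1}. g v \<noteq> g (counterfactual n E f i0 s v)}"

end

theory Submission
  imports Defs
begin

text \<open>
  A counterfactual keeps the noises of the non-sensitive features, so counterfactuals compose and the
  twin map is an involution of the feature space. Hence the unfair area is the set of points whose
  label differs from that of their twin, and it consists of twin pairs carrying opposite labels.
  Flipping a negative point to positive repairs exactly the pair to which it belongs, so the unfair
  area of the new classifier is the old one without \<open>C\<close> and without the positive partners of \<open>C\<close>.
\<close>

lemma counterfactual_extensional: "counterfactual n E f i0 s v \<in> extensional {1..n}"
  by (simp add: counterfactual_def)

context additive_noise_SCM
begin

lemma wf_edges: "wf E"
  using finite_subset[OF edges] acyclic by (intro finite_acyclic_wf) auto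

lemma parents_subset: "parents E i \<subseteq> {1..n}"
  using edges by (auto simp: parents_def)

lemmas counterfactual_simp = counterfactual_rec[OF edges acyclic]

text \<open>Induction along the edges: once the parents keep their values, the two mechanism terms
  in the recursion cancel and leave \<open>v i\<close>. Extensionality settles the coordinates
  outside \<open>{1..n}\<close>.\<close>

lemma counterfactual_self:
  assumes "v \<in> extensional {1..n}"
  shows "counterfactual n E f i0 (v i0) v = v"
proof (rule extensionalityI[OF counterfactual_extensional assms])
  fix i assume "i \<in> {1..n}"
  then show "counterfactual n E f i0 (v i0) v i = v i"
  proof (induction i rule: wf_induct_rule[OF wf_edges])
    case (1 i)
    have "(\<lambda>j\<in>parents E i. counterfactual n E f i0 (v i0) v j) = (\<lambda>j\<in>parents E i. v j)"
      using 1 parents_subset[of i] by (intro restrict_ext) (auto simp: parents_def)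
    then show ?case
      using 1(2) by (simp add: counterfactual_simp)
  qed
qed

text \<open>At a vertex other than \<open>i0\<close>, the inner counterfactual minus its own
  mechanism value is the residual of \<open>v\<close>, so the outer intervention starts from the
  same noises. At \<open>i0\<close> the inner value \<open>s\<close> is overwritten by
  \<open>t\<close>.\<close>

lemma counterfactual_counterfactual:
  "counterfactual n E f i0 t (counterfactual n E f i0 s v) = counterfactual n E f i0 t v"
    (is "?l = ?r")
proof (rule extensionalityI[OF counterfactual_extensional counterfactual_extensional])
  fix i assume "i \<in> {1..n}"
  then show "?l i = ?r i"
  proof (induction i rule: wf_induct_rule[OF wf_edges])
    case (1 i)
    have "(\<lambda>j\<in>parents E i. ?l j) = (\<lambda>j\<in>parents E i. ?r j)"
      using 1 parents_subset[of i] by (intro restrict_ext) (auto simp: parents_def)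
    then show ?case
      using counterfactual_simp[OF 1(2), of f i0 t "counterfactual n E f i0 s v"]
        counterfactual_simp[OF 1(2), of f i0 t v] counterfactual_simp[OF 1(2), of f i0 s v]
      by (cases "i = i0") simp_all
  qed
qed

lemma mechanism_compose_measurable:
  assumes "i \<in> {1..n}" "\<And>j. j \<in> parents E i \<Longrightarrow> w j \<in> borel_measurable N"
  shows "(\<lambda>x. f i (\<lambda>j\<in>parents E i. w j x)) \<in> borel_measurable N"
  by (rule measurable_compose[OF measurable_restrict mechanism_measurable]) (use assms in auto)

text \<open>The imposed value \<open>s\<close> may depend on \<open>v\<close> because the twin
  imposes \<open>1 - v i0\<close>. The recursion is handled one coordinate at a time, by induction
  along the edges.\<close>

lemma counterfactual_measurable:
  assumes s: "s \<in> borel_measurable (\<Pi>\<^sub>M i\<in>{1..n}. borel)"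
  shows "(\<lambda>v. counterfactual n E f i0 (s v) v) \<in> (\<Pi>\<^sub>M i\<in>{1..n}. borel) \<rightarrow>\<^sub>M (\<Pi>\<^sub>M i\<in>{1..n}. borel)"
proof (rule measurable_PiM_single')
  fix i assume "i \<in> {1..n}"
  then show "(\<lambda>v. counterfactual n E f i0 (s v) v i) \<in> borel_measurable (\<Pi>\<^sub>M i\<in>{1..n}. borel)"
  proof (induction i rule: wf_induct_rule[OF wf_edges])
    case (1 i)
    have 2: "j \<in> {1..n}" "(j, i) \<in> E" if "j \<in> parents E i" for j
      using that edges by (auto simp: parents_def)
    have "(\<lambda>v. f i (\<lambda>j\<in>parents E i. counterfactual n E f i0 (s v) v j))
        \<in> borel_measurable (\<Pi>\<^sub>M i\<in>{1..n}. borel)"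
      using 1 2 by (intro mechanism_compose_measurable) auto
    moreover have "(\<lambda>v. f i (\<lambda>j\<in>parents E i. v j)) \<in> borel_measurable (\<Pi>\<^sub>M i\<in>{1..n}. borel)"
      using 1 2 by (intro mechanism_compose_measurable) auto
    ultimately show ?case
      using s 1(2) by (cases "i = i0") (simp_all add: counterfactual_simp)
  qed
qed (use counterfactual_extensional in \<open>auto simp: PiE_def\<close>)

lemma noise_measurable: "i \<in> {1..n} \<Longrightarrow> U i \<in> borel_measurable M"
  using noise_indep by (auto simp: indep_vars_def)

text \<open>The structural equations carry measurability from the noises to the features along the
  graph. This makes \<open>feature_distr\<close> a genuine probability measure.\<close>

lemma feature_measurable: "i \<in> {1..n} \<Longrightarrow> V i \<in> borel_measurable M"
proof (induction i rule: wf_induct_rule[OF wf_edges])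
  case (1 i)
  have "(\<lambda>\<omega>. f i (\<lambda>j\<in>parents E i. V j \<omega>) + U i \<omega>) \<in> borel_measurable M"
    using 1 parents_subset[of i] noise_measurable
    by (intro borel_measurable_add mechanism_compose_measurable) (auto simp: parents_def)
  then show ?case
    using structural_equation[OF 1(2)] by (simp cong: measurable_cong)
qed

end

context binary_sensitive_SCM
begin

abbreviation "\<tau> \<equiv> twin n E f i0"

abbreviation "P \<equiv> feature_distr M n V FS"

lemma feature_extensional: "v \<in> FS \<Longrightarrow> v \<in> extensional {1..n}"
  using feature_space by (auto simp: space_PiM PiE_def)

lemma twin_in_space: "v \<in> FS \<Longrightarrow> \<tau> v \<in> FS"
  unfolding twin_def using sensitive_binary[of v] by (intro counterfactual_closed) auto

text \<open>The twin has attribute \<open>1 - v i0\<close>, so its own twin imposes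
  \<open>v i0\<close> again; by composition this is the counterfactual of \<open>v\<close> at its
  actual attribute value.\<close>

lemma twin_twin:
  assumes "v \<in> FS"
  shows "\<tau> (\<tau> v) = v"
  using counterfactual_self[OF feature_extensional[OF assms]]
  by (simp add: twin_def counterfactual_counterfactual counterfactual_simp[OF sensitive_index])

text \<open>One of the two values of \<open>s\<close> is \<open>v i0\<close>, which returns
  \<open>v\<close> and cannot witness unfairness; the other one yields the twin.\<close>

lemma unfair_area_iff_twin:
  "unfair_area n E f i0 FS g = {v \<in> FS. g v \<noteq> g (\<tau> v)}"
proof -
  have "(\<exists>s\<in>{0, 1}. g v \<noteq> g (counterfactual n E f i0 s v)) \<longleftrightarrow> g v \<noteq> g (\<tau> v)" if "v \<in> FS" for v
  proof -
    have self: "counterfactual n E f i0 (v i0) v = v"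
      by (rule counterfactual_self[OF feature_extensional[OF that]])
    have "v i0 = 0 \<or> v i0 = 1"
      using sensitive_binary[OF that] by simp
    then show ?thesis
      using self by (elim disjE) (simp_all add: twin_def)
  qed
  then show ?thesis unfolding unfair_area_def by blast
qed

lemma space_feature_distr: "space P = FS"
  using feature_space by (simp add: feature_distr_def space_restrict_space Int_absorb2)

lemma prob_space_feature_distr: "prob_space P"
  unfolding feature_distr_def
  using features_in_space feature_measurable
  by (intro prob_space_distr measurable_restrict_space2 measurable_restrict) auto

lemma twin_measurable: "\<tau> \<in> P \<rightarrow>\<^sub>M P"
proof -
  have "\<tau> \<in> (\<Pi>\<^sub>M i\<in>{1..n}. borel) \<rightarrow>\<^sub>M (\<Pi>\<^sub>M i\<in>{1..n}. borel)"
    unfolding twin_def using sensitive_index by (intro counterfactual_measurable) auto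
  \<comment> \<open>Passing to the trace \<sigma>-algebra on both sides is possible because
    \<open>\<tau>\<close> maps \<open>FS\<close> into itself.\<close>
  then have "\<tau> \<in> restrict_space (\<Pi>\<^sub>M i\<in>{1..n}. borel) FS \<rightarrow>\<^sub>M restrict_space (\<Pi>\<^sub>M i\<in>{1..n}. borel) FS"
    using twin_in_space
    by (intro measurable_restrict_space2 measurable_restrict_space1) (auto simp: space_restrict_space)
  then show ?thesis by (simp add: feature_distr_def)
qed

lemma twin_vimage_sets: "C \<in> sets P \<Longrightarrow> {v \<in> FS. \<tau> v \<in> C} \<in> sets P"
  using measurable_sets[OF twin_measurable]
  by (simp add: vimage_def Int_def space_feature_distr conj_commute)

text \<open>With only two labels, a point and its twin disagree iff exactly one of them is labelled
  1. The area is thus the symmetric difference of \<open>?B\<close> and its preimage under the twin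
  map.\<close>

lemma unfair_area_sets:
  assumes g: "g \<in> P \<rightarrow>\<^sub>M count_space {-1, 1 :: int}"
  shows "unfair_area n E f i0 FS g \<in> sets P"
proof -
  let ?B = "{v \<in> FS. g v = 1}"
  have "?B = g -` {1} \<inter> space P"
    by (auto simp: space_feature_distr)
  then have B: "?B \<in> sets P"
    using measurable_sets[OF g, of "{1}"] by simp
  have labels: "g v = -1 \<or> g v = 1" if "v \<in> FS" for v
    using measurable_space[OF g, of v] that by (simp add: space_feature_distr)
  have "g v \<noteq> g (\<tau> v) \<longleftrightarrow> (g v = 1) \<noteq> (g (\<tau> v) = 1)" if "v \<in> FS" for v
    using labels[OF that] labels[OF twin_in_space[OF that]] by (elim disjE) simp_all
  then have "unfair_area n E f i0 FS g = (?B - {v \<in> FS. \<tau> v \<in> ?B}) \<union> ({v \<in> FS. \<tau> v \<in> ?B} - ?B)"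
    using twin_in_space by (auto simp: unfair_area_iff_twin)
  moreover have "{v \<in> FS. \<tau> v \<in> ?B} \<in> sets P"
    by (rule twin_vimage_sets[OF B])
  ultimately show ?thesis
    using B by (simp only: sets.Un sets.Diff)
qed

end

theorem proposition4:
  fixes M :: "'w measure" and n i0 :: nat and E :: "(nat \<times> nat) set" and f :: mechanism
    and U V :: "nat \<Rightarrow> 'w \<Rightarrow> real" and FS :: "(nat \<Rightarrow> real) set"
    and h h' :: "(nat \<Rightarrow> real) \<Rightarrow> int" and A A_pos A_neg C C_pos :: "(nat \<Rightarrow> real) set"
    and P :: "(nat \<Rightarrow> real) measure"
  assumes SCM: "binary_sensitive_SCM M n E f U V i0 FS"
    and P_def: "P = feature_distr M n V FS"
    and h: "h \<in> P \<rightarrow>\<^sub>M count_space {-1, 1}"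
    and A_def: "A = unfair_area n E f i0 FS h"
    and A_pos_def: "A_pos = {v \<in> A. h v = 1}"
    and A_neg_def: "A_neg = {v \<in> A. h v = -1}"
    and C: "C \<in> sets P" "C \<subseteq> A_neg"
    and h'_def: "h' = (\<lambda>v. if v \<in> C then 1 else h v)"
    and C_pos_def: "C_pos = {v \<in> A_pos. twin n E f i0 v \<in> C}"
  shows "A \<in> sets P \<and> C_pos \<in> sets P \<and> unfair_area n E f i0 FS h' \<in> sets P
    \<and> measure P (unfair_area n E f i0 FS h') = measure P A - measure P C - measure P C_pos
    \<and> (C = A_neg \<longrightarrow> measure P (unfair_area n E f i0 FS h') = 0)"
proof -
  interpret binary_sensitive_SCM M n E f U V i0 FS by (rule SCM)
  let ?A' = "unfair_area n E f i0 FS h'"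
  interpret P: prob_space P
    unfolding P_def by (rule prob_space_feature_distr)
  have labels: "h v = -1 \<or> h v = 1" if "v \<in> FS" for v
    using measurable_space[OF h] that by (auto simp: P_def space_feature_distr)
  have A: "A = {v \<in> FS. h v \<noteq> h (twin n E f i0 v)}"
    by (simp add: A_def unfair_area_iff_twin)
  have A_sets: "A \<in> sets P"
    using unfair_area_sets h unfolding A_def P_def by blast
  \<comment> \<open>Points of \<open>C\<close> are negative and unfair, so their twins are positive;
    in particular \<open>C\<close> never contains both members of a twin pair.\<close>
  have neg: "h v = -1" "v \<in> FS" "h (twin n E f i0 v) = 1" if "v \<in> C" for v
    using that C(2) labels twin_in_space unfolding A_neg_def A by force+
  \<comment> \<open>Membership in \<open>A_pos\<close> is automatic: \<open>neg\<close> applied to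
    the twin, together with \<open>twin_twin\<close>, gives \<open>v\<close> the label 1 and its
    twin the label -1.\<close>
  have C_pos: "C_pos = {v \<in> FS. twin n E f i0 v \<in> C}"
    using neg twin_twin unfolding C_pos_def A_pos_def A by fastforce
  have C_pos_sets: "C_pos \<in> sets P"
    unfolding C_pos using C(1) twin_vimage_sets unfolding P_def by blast
  have A': "?A' = A - (C \<union> C_pos)"
  proof (rule set_eqI)
    fix v
    show "v \<in> ?A' \<longleftrightarrow> v \<in> A - (C \<union> C_pos)"
    proof (cases "v \<in> FS")
      case True
      \<comment> \<open>If \<open>v\<close> or its twin is in \<open>C\<close>, then exactly one of
        them is flipped and both end with label 1. Otherwise neither label changes.\<close>
      show ?thesis
        using neg[of v] neg[of "twin n E f i0 v"] twin_twin[OF True] True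
        by (auto simp: unfair_area_iff_twin A C_pos h'_def)
    qed (simp add: unfair_area_iff_twin A)
  qed
  have sub: "C \<union> C_pos \<subseteq> A"
    using C(2) by (auto simp: A_neg_def C_pos_def A_pos_def)
  have disj: "C \<inter> C_pos = {}"
    using neg by (auto simp: C_pos_def A_pos_def)
  have "measure P ?A' = measure P A - measure P (C \<union> C_pos)"
    unfolding A' using A_sets C(1) C_pos_sets sub by (intro P.finite_measure_Diff) auto
  also have "measure P (C \<union> C_pos) = measure P C + measure P C_pos"
    using C(1) C_pos_sets disj by (rule P.finite_measure_Union)
  finally have "measure P ?A' = measure P A - measure P C - measure P C_pos"
    by simp
  moreover have "?A' = {}" if "C = A_neg"
  proof -
    \<comment> \<open>Such a \<open>v\<close> is unfair but not negative, hence positive. Its twin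
      is then negative, and unfair as well by \<open>twin_twin\<close>, so it lies in
      \<open>A_neg = C\<close>.\<close>
    have "v \<in> C_pos" if "v \<in> A" "v \<notin> C" for v
      using that \<open>C = A_neg\<close> labels[of v] labels[of "twin n E f i0 v"] twin_in_space twin_twin
      by (auto simp: C_pos A_neg_def A)
    then show ?thesis unfolding A' by blast
  qed
  moreover have "?A' \<in> sets P"
    unfolding A' using A_sets C(1) C_pos_sets by auto
  ultimately show ?thesis
    using A_sets C_pos_sets by simp
qed

end
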